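(* Let $P$ be a zero-one matrix such that every column of $P$ has at most one 1-entry. Then there is a constant $c>0$ such that every $n\times n$ zero-one matrix that is both $P$-free and $P^c$-free contains a homogeneous $cn\times cn$ submatrix.
   Context: The complement $P^c$ of a zero-one matrix $P$ is obtained by replacing 1-entries with 0s and 0-entries with 1s. A matrix is homogeneous if all its entries are equal. A $k\times \ell$ matrix $P$ is contained in $A$ if there are rows $i_1<\dots<i_k$ and columns $j_1<\dots<j_\ell$ of $A$ with $A(i_a,j_b)=P(a,b)$ for all $a,b$; $A$ is $P$-free if it does not contain $P$. Floors and ceilings are omitted. *)

theory Defs
  imports Complex_Main "Jordan_Normal_Form.Matrix"
begin

definition zero_one_mat :: "int mat \<Rightarrow> bool" where
  "zero_one_mat A \<longleftrightarrow> elements_mat A \<subseteq> {0, 1}"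

definition compl_mat :: "int mat \<Rightarrow> int mat" where
  "compl_mat P = map_mat (\<lambda>x. if x = 0 then 1 else 0) P"

definition homogeneous_mat :: "int mat \<Rightarrow> bool" where
  "homogeneous_mat A \<longleftrightarrow> (\<forall>x \<in> elements_mat A. \<forall>y \<in> elements_mat A. x = y)"

text \<open>The maps \<open>r\<close> and \<open>s\<close> list the chosen rows and columns of \<open>A\<close> in increasing order;
  they need not be consecutive.\<close>

definition contains_mat :: "int mat \<Rightarrow> int mat \<Rightarrow> bool" where
  "contains_mat A P \<longleftrightarrow>
     (\<exists>r s :: nat \<Rightarrow> nat.
        strict_mono_on {..<dim_row P} r \<and> r ` {..<dim_row P} \<subseteq> {..<dim_row A} \<and>
        strict_mono_on {..<dim_col P} s \<and> s ` {..<dim_col P} \<subseteq> {..<dim_col A} \<and>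
        (\<forall>a < dim_row P. \<forall>b < dim_col P. A $$ (r a, s b) = P $$ (a, b)))"

definition mat_free :: "int mat \<Rightarrow> int mat \<Rightarrow> bool" where
  "mat_free P A \<longleftrightarrow> \<not> contains_mat A P"

end

theory Submission
  imports Defs "HOL-Library.FuncSet"
begin

text \<open>Cut rows and columns into consecutive blocks and look for copies of \<open>P\<close> using one row
  or column of each block. Choosing the rows greedily, while shrinking each column block to the columns
  that still agree with \<open>P\<close>, either finds a copy or gets stuck at a linear-sized submatrix whose rows
  all contain only a small proportion of one symbol \<open>b\<close>. Cut that submatrix into blocks again.
  If it has no linear-sized homogeneous submatrix avoiding \<open>b\<close>, then once all chosen rows
  but one are fixed, nearly every choice of the last row has a \<open>b\<close> in a column of a given block
  where the other chosen rows have none. Hence a random choice of rows yields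
  the pattern with at most one \<open>b\<close> per column, which is \<open>P\<close> or its complement according to \<open>b\<close>.\<close>

section \<open>Transversals of blocks and the pigeonhole principle\<close>

text \<open>The index and point types are arbitrary, so the two arguments below never touch the
  order of rows and columns; order enters only when the blocks are chosen. \<open>E\<close> and
  \<open>p\<close> are Boolean so that either symbol of a zero-one matrix can play the role of
  "true".\<close>

definition transversal_copy ::
  "'i set \<Rightarrow> 'j set \<Rightarrow> ('i \<Rightarrow> 'a set) \<Rightarrow> ('j \<Rightarrow> 'b set) \<Rightarrow> ('a \<Rightarrow> 'b \<Rightarrow> bool) \<Rightarrow> ('i \<Rightarrow> 'j \<Rightarrow> bool) \<Rightarrow> bool"
  where "transversal_copy I J R C E p \<longleftrightarrow>
    (\<exists>r s. (\<forall>i\<in>I. r i \<in> R i) \<and> (\<forall>j\<in>J. s j \<in> C j) \<and> (\<forall>i\<in>I. \<forall>j\<in>J. E (r i) (s j) = p i j))"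

text \<open>If every \<open>B j\<close> had fewer than \<open>card S / card J\<close> elements, the
  union bound would make the union smaller than \<open>S\<close>. The multiplied form avoids
  division.\<close>

lemma pigeonhole_UN:
  assumes "finite J" and "\<And>j. j \<in> J \<Longrightarrow> finite (B j)" and "S \<subseteq> (\<Union>j\<in>J. B j)" and "S \<noteq> {}"
  shows "\<exists>j\<in>J. card S \<le> card J * card (B j)"
proof (rule ccontr)
  assume "\<not> ?thesis"
  then have less: "card J * card (B j) < card S" if "j \<in> J" for j
    using that by force
  have "J \<noteq> {}" using assms(3,4) by auto
  have "card S \<le> card (\<Union>j\<in>J. B j)"
    using assms by (intro card_mono) auto
  also have "\<dots> \<le> (\<Sum>j\<in>J. card (B j))"
    by (rule card_UN_le[OF assms(1)])
  finally have "card J * card S \<le> (\<Sum>j\<in>J. card J * card (B j))"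
    by (simp flip: sum_distrib_left)
  also have "\<dots> < (\<Sum>j\<in>J. card S)"
    using less assms(1) \<open>J \<noteq> {}\<close> by (intro sum_strict_mono) auto
  finally show False by simp
qed

section \<open>Greedy choice of rows\<close>

text \<open>Rows are fixed one at a time. A row is good if, in every column block, at least a
  \<open>1/m\<close> share of the columns agrees with \<open>p\<close>; fixing a good row shrinks
  the column blocks by a factor of at most \<open>m\<close>, hence the power of \<open>m\<close>.
  The columns change during the induction, so \<open>C\<close> is generalised. If a row block has no
  good row, one column block is to blame for a \<open>1 / card J\<close> share of it.\<close>

lemma transversal_copy_or_sparse:
  fixes E :: "'a \<Rightarrow> 'b \<Rightarrow> bool"
  assumes "finite I" and "finite J" and "m > 0"
    and "\<And>i. i \<in> I \<Longrightarrow> finite (R i) \<and> R i \<noteq> {}"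
    and "\<And>j. j \<in> J \<Longrightarrow> finite (C j) \<and> C j \<noteq> {}"
    and "\<not> transversal_copy I J R C E p"
  shows "\<exists>i\<in>I. \<exists>j\<in>J. \<exists>X Y b. X \<subseteq> R i \<and> Y \<subseteq> C j \<and> card (R i) \<le> card J * card X \<and>
    card (C j) \<le> m ^ card I * card Y \<and> (\<forall>x\<in>X. m * card {y\<in>Y. E x y = b} < card Y)"
  using assms(1,4-)
proof (induction I arbitrary: C rule: finite_induct)
  \<comment> \<open>With all rows placed, every surviving column agrees with \<open>p\<close> on
    them, so any element of each nonempty block completes a copy. The row map is unconstrained,
    hence \<open>undefined\<close>.\<close>
  case empty
  have "\<forall>j\<in>J. (SOME y. y \<in> C j) \<in> C j"
    using empty.prems(2) by (simp add: some_in_eq)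
  then have "transversal_copy {} J R C E p"
    unfolding transversal_copy_def by (intro exI[of _ undefined] exI[of _ "\<lambda>j. SOME y. y \<in> C j"]) simp
  with empty.prems show ?case by simp
next
  case (insert i I)
  \<comment> \<open>\<open>B j\<close> holds the rows of \<open>R i\<close> that are bad because of
    block \<open>j\<close>; for these the rare symbol is \<open>p i j\<close>.\<close>
  define B where "B = (\<lambda>j. {x \<in> R i. m * card {y \<in> C j. E x y = p i j} < card (C j)})"
  show ?case
  proof (cases "R i \<subseteq> (\<Union>j\<in>J. B j)")
    case True
    then obtain j where j: "j \<in> J" "card (R i) \<le> card J * card (B j)"
      using pigeonhole_UN[of J B "R i"] assms(2) insert.prems(1) by (auto simp: B_def)
    have "card (C j) \<le> m ^ card (insert i I) * card (C j)"
      using assms(3) by simp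
    moreover have "\<forall>x\<in>B j. m * card {y \<in> C j. E x y = p i j} < card (C j)" "B j \<subseteq> R i"
      by (auto simp: B_def)
    ultimately show ?thesis using j by blast
  next
    case False
    then obtain x where x: "x \<in> R i" "\<And>j. j \<in> J \<Longrightarrow> x \<notin> B j" by blast
    define C' where "C' = (\<lambda>j. {y \<in> C j. E x y = p i j})"
    have large: "card (C j) \<le> m * card (C' j)" if "j \<in> J" for j
      using x that by (force simp: B_def C'_def)
    have sub: "C' j \<subseteq> C j" for j by (auto simp: C'_def)
    have C': "finite (C' j) \<and> C' j \<noteq> {}" if "j \<in> J" for j
    proof -
      have "card (C j) > 0" using insert.prems(2)[OF that] by (simp add: card_gt_0_iff)
      then have "card (C' j) > 0" using large[OF that] by (cases "card (C' j)") auto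
      then show ?thesis by (simp add: card_gt_0_iff)
    qed
    have no_copy: "\<not> transversal_copy I J R C' E p"
    proof
      assume "transversal_copy I J R C' E p"
      then obtain r s where rs: "\<forall>i\<in>I. r i \<in> R i" "\<forall>j\<in>J. s j \<in> C' j"
        "\<forall>i\<in>I. \<forall>j\<in>J. E (r i) (s j) = p i j"
        unfolding transversal_copy_def by blast
      have "transversal_copy (insert i I) J R C E p"
        \<comment> \<open>Agreement of the new row \<open>x\<close> with \<open>p\<close> is built
          into \<open>C'\<close>, so only row \<open>i\<close> has to be added to the copy.\<close>
        unfolding transversal_copy_def
        by (rule exI[of _ "r(i := x)"], rule exI[of _ s])
          (use rs x insert.hyps in \<open>auto simp: C'_def\<close>)
      with insert.prems(3) show False by blast
    qed
    have R': "finite (R i') \<and> R i' \<noteq> {}" if "i' \<in> I" for i'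
      using that insert.prems(1) by blast
    have "\<exists>i\<in>I. \<exists>j\<in>J. \<exists>X Y b. X \<subseteq> R i \<and> Y \<subseteq> C' j \<and> card (R i) \<le> card J * card X \<and>
        card (C' j) \<le> m ^ card I * card Y \<and> (\<forall>x\<in>X. m * card {y\<in>Y. E x y = b} < card Y)"
      by (rule insert.IH[OF _ _ no_copy], erule R', erule C')
    then obtain i' j X Y b where *: "i' \<in> I" "j \<in> J" "X \<subseteq> R i'" "Y \<subseteq> C' j"
      "card (R i') \<le> card J * card X" "card (C' j) \<le> m ^ card I * card Y"
      "\<forall>x\<in>X. m * card {y\<in>Y. E x y = b} < card Y"
      by (elim bexE exE conjE) (rule that)
    have "card (C j) \<le> m * (m ^ card I * card Y)"
      using large[OF *(2)] *(6) by (meson le_trans mult_le_mono2)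
    then have "card (C j) \<le> m ^ card (insert i I) * card Y"
      using insert.hyps by (simp add: mult.assoc)
    with * sub show ?thesis by (meson insertI2 subset_trans)
  qed
qed

section \<open>Counting choices of rows in a sparse submatrix\<close>

text \<open>A choice \<open>r\<close> is determined by its restriction \<open>g\<close> to
  \<open>I - {i}\<close> together with \<open>r i\<close>. Summing over all \<open>g\<close> the
  number of bad values at \<open>i\<close> gives the bound.\<close>

lemma card_PiE_slices_le:
  assumes "finite I" and "i \<in> I" and "\<And>i. i \<in> I \<Longrightarrow> finite (R i)"
    and "\<And>g. g \<in> PiE (I - {i}) R \<Longrightarrow> card {x \<in> R i. Q (g(i := x))} \<le> t"
  shows "card {r \<in> PiE I R. Q r} \<le> t * (\<Prod>i'\<in>I - {i}. card (R i'))"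
proof -
  let ?S = "SIGMA g:PiE (I - {i}) R. {x \<in> R i. Q (g(i := x))}"
  have fin: "finite (PiE (I - {i}) R)"
    using assms by (intro finite_PiE) auto
  have "{r \<in> PiE I R. Q r} \<subseteq> (\<lambda>(g, x). g(i := x)) ` ?S"
  proof
    fix r assume r: "r \<in> {r \<in> PiE I R. Q r}"
    have "(restrict r (I - {i}))(i := r i) = r"
      using r assms(2) by (auto simp: fun_eq_iff PiE_def extensional_def)
    with r assms(2) show "r \<in> (\<lambda>(g, x). g(i := x)) ` ?S"
      by (intro image_eqI[of _ _ "(restrict r (I - {i}), r i)"]) auto
  qed
  then have "card {r \<in> PiE I R. Q r} \<le> card ?S"
    using fin assms(2,3) by (intro surj_card_le) auto
  also have "\<dots> = (\<Sum>g\<in>PiE (I - {i}) R. card {x \<in> R i. Q (g(i := x))})"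
    using fin assms(2,3) by (intro card_SigmaI) auto
  also have "\<dots> \<le> (\<Sum>g\<in>PiE (I - {i}) R. t)"
    using assms(4) by (intro sum_mono) auto
  finally show ?thesis using assms(1) by (simp add: card_PiE mult.commute)
qed

text \<open>Sparsity makes avoiding \<open>E\<close> on all chosen rows easy, so the only obstacle
  in column \<open>j\<close> is the single row where \<open>p\<close> demands \<open>E\<close>. If
  that demand failed too often with the other rows fixed, the failing rows and the columns avoided
  by the others would span an \<open>E\<close>-free block. Otherwise the failures are too few to
  cover all choices of rows.\<close>

lemma transversal_copy_or_empty:
  fixes E :: "'a \<Rightarrow> 'b \<Rightarrow> bool"
  assumes "finite I" and "finite J"
    and R: "\<And>i. i \<in> I \<Longrightarrow> finite (R i) \<and> R i \<noteq> {}"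
    and C: "\<And>j. j \<in> J \<Longrightarrow> finite (C j) \<and> C j \<noteq> {}"
    and sparse: "\<And>i j x. i \<in> I \<Longrightarrow> j \<in> J \<Longrightarrow> x \<in> R i \<Longrightarrow>
      2 * (card I + 1) * card {y \<in> C j. E x y} < card (C j)"
    and single: "\<And>i i' j. i \<in> I \<Longrightarrow> i' \<in> I \<Longrightarrow> j \<in> J \<Longrightarrow> p i j \<Longrightarrow> p i' j \<Longrightarrow> i = i'"
    and "\<not> transversal_copy I J R C E p"
  shows "\<exists>i\<in>I. \<exists>j\<in>J. \<exists>X Y. X \<subseteq> R i \<and> Y \<subseteq> C j \<and> card (R i) \<le> card J * card X \<and>
    card (C j) \<le> 2 * card Y \<and> (\<forall>x\<in>X. \<forall>y\<in>Y. \<not> E x y)"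
proof (rule ccontr)
  assume neg: "\<not> ?thesis"
  \<comment> \<open>A row choice outside every \<open>B j\<close> extends to a copy, since the
    columns of different blocks are chosen independently. Hence the \<open>B j\<close> must cover
    all row choices.\<close>
  define B where "B = (\<lambda>j. {r \<in> PiE I R. \<not> (\<exists>y \<in> C j. \<forall>i\<in>I. E (r i) y = p i j)})"
  have fin: "finite (PiE I R)" using assms(1) R by (intro finite_PiE) auto
  have ne: "PiE I R \<noteq> {}" using R by (auto simp: PiE_eq_empty_iff)
  have pos: "(\<Prod>i\<in>I'. card (R i)) > 0" if "I' \<subseteq> I" for I'
    using R that by (intro prod_pos) (auto simp: card_gt_0_iff subset_iff)
  \<comment> \<open>The rows of \<open>I'\<close> are at most \<open>card I\<close> many, and each
    has \<open>E\<close> on less than a \<open>1 / (2 * (card I + 1))\<close> share of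
    \<open>C j\<close>, so at least half of \<open>C j\<close> avoids them all. The
    \<open>+ 1\<close> keeps the factor cancelled below positive even for empty
    \<open>I\<close>.\<close>
  have free: "card (C j) \<le> 2 * card (C j - (\<Union>i\<in>I'. {y \<in> C j. E (r i) y})) \<and>
      C j - (\<Union>i\<in>I'. {y \<in> C j. E (r i) y}) \<noteq> {}"
    if "j \<in> J" "I' \<subseteq> I" "\<forall>i\<in>I'. r i \<in> R i" for j I' r
  proof -
    let ?U = "\<Union>i\<in>I'. {y \<in> C j. E (r i) y}"
    have fI': "finite I'" "card I' \<le> card I"
      using that(2) assms(1) by (auto intro: finite_subset card_mono)
    have "2 * (card I + 1) * card ?U \<le> 2 * (card I + 1) * (\<Sum>i\<in>I'. card {y \<in> C j. E (r i) y})"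
      by (intro mult_le_mono2 card_UN_le fI')
    also have "\<dots> = (\<Sum>i\<in>I'. 2 * (card I + 1) * card {y \<in> C j. E (r i) y})"
      by (rule sum_distrib_left)
    also have "\<dots> \<le> (\<Sum>i\<in>I'. card (C j))"
      using sparse that by (intro sum_mono less_imp_le) blast
    also have "\<dots> \<le> (card I + 1) * card (C j)"
      using fI'(2) by (simp only: sum_constant of_nat_id, intro mult_le_mono1) linarith
    finally have "(card I + 1) * (2 * card ?U) \<le> (card I + 1) * card (C j)"
      by (simp only: ac_simps)
    then have "2 * card ?U \<le> card (C j)"
      by (simp only: mult_le_cancel1)
    moreover have "card (C j - ?U) = card (C j) - card ?U"
      using C[OF that(1)] by (intro card_Diff_subset) (auto intro: finite_subset)
    moreover have "card (C j) > 0"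
      using C[OF that(1)] by (simp add: card_gt_0_iff)
    ultimately have "card (C j) \<le> 2 * card (C j - ?U)" "card (C j - ?U) > 0" by linarith+
    then show ?thesis by (metis card.empty less_irrefl)
  qed
  have "PiE I R \<subseteq> (\<Union>j\<in>J. B j)"
  proof
    fix r assume r: "r \<in> PiE I R"
    show "r \<in> (\<Union>j\<in>J. B j)"
    proof (rule ccontr)
      assume "r \<notin> (\<Union>j\<in>J. B j)"
      with r have "\<forall>j\<in>J. \<exists>y. y \<in> C j \<and> (\<forall>i\<in>I. E (r i) y = p i j)" by (auto simp: B_def)
      then obtain s where "\<forall>j\<in>J. s j \<in> C j \<and> (\<forall>i\<in>I. E (r i) (s j) = p i j)" by metis
      with r have "transversal_copy I J R C E p"
        unfolding transversal_copy_def by (intro exI[of _ r] exI[of _ s]) auto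
      with assms(7) show False by blast
    qed
  qed
  then obtain j where j: "j \<in> J" "card (PiE I R) \<le> card J * card (B j)"
    using pigeonhole_UN[of J B "PiE I R"] assms(2) fin ne by (auto simp: B_def)
  have "B j \<noteq> {}"
    using j(2) fin ne by (auto simp: card_gt_0_iff)
  then obtain r0 where r0: "r0 \<in> B j" by blast
  show False
  proof (cases "\<exists>i\<in>I. p i j")
    case False
    have "\<forall>i\<in>I. r0 i \<in> R i" using r0 by (auto simp: B_def)
    then obtain y where "y \<in> C j" "\<forall>i\<in>I. \<not> E (r0 i) y"
      using free[OF j(1) subset_refl, of r0] by blast
    with False r0 show False by (auto simp: B_def)
  next
    case True
    then obtain i where i: "i \<in> I" "p i j" by blast
    \<comment> \<open>The largest \<open>t\<close> with \<open>card J * t < card (R i)\<close>; the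
      \<open>- 1\<close> yields the strict inequality that closes the count.\<close>
    define t where "t = (card (R i) - 1) div card J"
    have Jpos: "card J > 0" using j(1) assms(2) by (auto simp: card_gt_0_iff)
    have "card {r \<in> PiE I R. \<not> (\<exists>y \<in> C j. \<forall>i\<in>I. E (r i) y = p i j)}
        \<le> t * (\<Prod>i'\<in>I - {i}. card (R i'))"
    proof (rule card_PiE_slices_le)
      fix g assume g: "g \<in> PiE (I - {i}) R"
      \<comment> \<open>For fixed other rows \<open>g\<close>, \<open>X\<close> holds the failing
        choices of row \<open>i\<close> and \<open>Y\<close> the columns on which \<open>g\<close>
        avoids \<open>E\<close>. An \<open>E\<close> at a point of \<open>X\<close> and
        \<open>Y\<close> would realise column \<open>j\<close> of \<open>p\<close>, whose only true
        entry is at \<open>i\<close>; so \<open>X\<close> and \<open>Y\<close> span an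
        \<open>E\<close>-free block, and \<open>neg\<close> forces \<open>X\<close> to be
        small.\<close>
      define X where "X = {x \<in> R i. \<not> (\<exists>y \<in> C j. \<forall>i'\<in>I. E ((g(i := x)) i') y = p i' j)}"
      define Y where "Y = C j - (\<Union>i'\<in>I - {i}. {y \<in> C j. E (g i') y})"
      have "card (C j) \<le> 2 * card Y"
        using free[OF j(1), of "I - {i}" g] g by (auto simp: Y_def)
      moreover have "\<not> E x y" if "x \<in> X" "y \<in> Y" for x y
      proof
        assume "E x y"
        have "E ((g(i := x)) i') y = p i' j" if "i' \<in> I" for i'
        proof (cases "i' = i")
          case True
          with \<open>E x y\<close> i(2) show ?thesis by simp
        next
          case False
          then have "\<not> p i' j" using single[OF that i(1) j(1) _ i(2)] by blast
          with False that \<open>y \<in> Y\<close> show ?thesis by (simp add: Y_def)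
        qed
        moreover have "y \<in> C j" using \<open>y \<in> Y\<close> by (simp add: Y_def)
        ultimately show False using \<open>x \<in> X\<close> unfolding X_def by blast
      qed
      moreover have "X \<subseteq> R i" "Y \<subseteq> C j" by (auto simp: X_def Y_def)
      ultimately have "\<not> card (R i) \<le> card J * card X"
        using neg i(1) j(1) by blast
      then have "card J * card X \<le> card (R i) - 1" by simp
      then show "card X \<le> t"
        using Jpos by (simp add: t_def less_eq_div_iff_mult_less_eq mult.commute)
    qed (use assms(1) i R in auto)
    \<comment> \<open>The pigeonhole bound for \<open>B j\<close> now conflicts with
      \<open>card J * t < card (R i)\<close>: both sides carry the same positive product over the
      other rows.\<close>
    then have "card (PiE I R) \<le> card J * t * (\<Prod>i'\<in>I - {i}. card (R i'))"
      using le_trans[OF j(2)] mult_le_mono2[of _ _ "card J"] by (simp only: B_def mult.assoc)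
    moreover have "card J * t < card (R i)"
    proof -
      have "card (R i) > 0" using R[OF i(1)] by (simp add: card_gt_0_iff)
      moreover have "card J * t \<le> card (R i) - 1" by (simp add: t_def)
      ultimately show ?thesis by linarith
    qed
    moreover have "card (PiE I R) = card (R i) * (\<Prod>i'\<in>I - {i}. card (R i'))"
      using assms(1) i(1) by (simp add: card_PiE prod.remove)
    ultimately show False using pos[of "I - {i}"] by auto
  qed
qed

section \<open>From ordered blocks to contained matrices\<close>

text \<open>The sorted enumeration of \<open>X\<close> is cut into consecutive index intervals of
  length \<open>q\<close>; a remainder at the end is discarded.\<close>

lemma ordered_blocks:
  fixes X :: "'a :: linorder set"
  assumes "finite X" and "k * q \<le> card X"
  shows "\<exists>R :: nat \<Rightarrow> 'a set. (\<forall>i<k. R i \<subseteq> X \<and> card (R i) = q) \<and>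
    (\<forall>i<k. \<forall>i'<i. \<forall>x\<in>R i'. \<forall>y\<in>R i. x < y)"
proof -
  define xs where "xs = sorted_list_of_set X"
  have xs: "sorted_wrt (<) xs" "set xs = X" "length xs = card X" "distinct xs"
    using assms(1) by (auto simp: xs_def)
  define R where "R = (\<lambda>i. (!) xs ` {i * q..<(i + 1) * q})"
  have len: "(i + 1) * q \<le> length xs" if "i < k" for i
  proof -
    have "(i + 1) * q \<le> k * q" using that by (intro mult_le_mono1) simp
    with assms(2) xs(3) show ?thesis by linarith
  qed
  have "R i \<subseteq> X" if "i < k" for i
    using len[OF that] xs(2) by (auto simp: R_def intro!: nth_mem)
  moreover have "card (R i) = q" if "i < k" for i
  proof -
    have "inj_on ((!) xs) {i * q..<(i + 1) * q}"
      using len[OF that] xs(4) by (intro inj_on_nth) auto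
    then show ?thesis by (simp add: R_def card_image)
  qed
  moreover have "x < y" if "i < k" "i' < i" and xy: "x \<in> R i'" "y \<in> R i" for i i' x y
  proof -
    obtain u v where uv: "x = xs ! u" "u < (i' + 1) * q" "y = xs ! v" "i * q \<le> v" "v < (i + 1) * q"
      using xy unfolding R_def image_iff by (metis atLeastLessThan_iff)
    have "(i' + 1) * q \<le> i * q" using that by (intro mult_le_mono1) simp
    then show ?thesis
      using uv len[OF that(1)] sorted_wrt_nth_less[OF xs(1), of u v] by simp
  qed
  ultimately show ?thesis by blast
qed

text \<open>Ordered blocks make any transversal strictly increasing. Since only two symbols occur,
  agreeing on where \<open>b\<close> stands means agreeing everywhere. Leaving \<open>b\<close> free
  covers both \<open>P\<close> with symbol 1 and its complement with symbol 0.\<close>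

lemma contains_mat_if_transversal_copy:
  assumes "zero_one_mat A" and "zero_one_mat Q"
    and "transversal_copy {..<dim_row Q} {..<dim_col Q} R C
      (\<lambda>x y. A $$ (x, y) = b) (\<lambda>i j. Q $$ (i, j) = b)"
    and "b = 0 \<or> b = 1"
    and "\<And>i. i < dim_row Q \<Longrightarrow> R i \<subseteq> {..<dim_row A}"
    and "\<And>j. j < dim_col Q \<Longrightarrow> C j \<subseteq> {..<dim_col A}"
    and "\<forall>i<dim_row Q. \<forall>i'<i. \<forall>x\<in>R i'. \<forall>y\<in>R i. x < y"
    and "\<forall>j<dim_col Q. \<forall>j'<j. \<forall>x\<in>C j'. \<forall>y\<in>C j. x < y"
  shows "contains_mat A Q"
proof -
  obtain r s where rs: "\<forall>i<dim_row Q. r i \<in> R i" "\<forall>j<dim_col Q. s j \<in> C j"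
    "\<forall>i<dim_row Q. \<forall>j<dim_col Q. (A $$ (r i, s j) = b) = (Q $$ (i, j) = b)"
    using assms(3) unfolding transversal_copy_def by auto
  have entry: "B $$ (x, y) = 0 \<or> B $$ (x, y) = 1"
    if "zero_one_mat B" "x < dim_row B" "y < dim_col B" for B x y
    using that by (force simp: zero_one_mat_def elements_mat_def)
  have r: "r i < dim_row A" if "i < dim_row Q" for i
    using assms(5)[OF that] rs(1) that by auto
  have s: "s j < dim_col A" if "j < dim_col Q" for j
    using assms(6)[OF that] rs(2) that by auto
  have "A $$ (r i, s j) = Q $$ (i, j)" if "i < dim_row Q" "j < dim_col Q" for i j
    using entry[OF assms(1) r[OF that(1)] s[OF that(2)]] entry[OF assms(2) that] rs(3) that assms(4)
    by (metis zero_neq_one)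
  moreover have "strict_mono_on {..<dim_row Q} r"
    using rs(1) assms(7) by (intro strict_mono_onI) (meson lessThan_iff)
  moreover have "strict_mono_on {..<dim_col Q} s"
    using rs(2) assms(8) by (intro strict_mono_onI) (meson lessThan_iff)
  ultimately show ?thesis
    unfolding contains_mat_def using r s by (intro exI[of _ r] exI[of _ s]) auto
qed

lemma contains_homogeneous_mat:
  assumes "X \<subseteq> {..<dim_row A}" and "Y \<subseteq> {..<dim_col A}"
    and "\<And>x y. x \<in> X \<Longrightarrow> y \<in> Y \<Longrightarrow> A $$ (x, y) = a"
    and "t \<le> card X" and "t \<le> card Y"
  shows "\<exists>B \<in> carrier_mat t t. contains_mat A B \<and> homogeneous_mat B"
proof -
  have enum: "\<exists>r. strict_mono_on {..<t} r \<and> r ` {..<t} \<subseteq> Z"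
    if "finite Z" "t \<le> card Z" for Z :: "nat set"
  proof -
    have "strict_mono_on {..<t} ((!) (sorted_list_of_set Z))"
      using that by (intro strict_mono_onI sorted_wrt_nth_less[where P = "(<)"]) auto
    moreover have "(!) (sorted_list_of_set Z) ` {..<t} \<subseteq> Z"
      using that nth_mem[of _ "sorted_list_of_set Z"] by auto
    ultimately show ?thesis by blast
  qed
  obtain r s where rs: "strict_mono_on {..<t} r" "r ` {..<t} \<subseteq> X"
    "strict_mono_on {..<t} s" "s ` {..<t} \<subseteq> Y"
    using enum[of X] enum[of Y] assms by (meson finite_lessThan finite_subset)
  have "contains_mat A (mat t t (\<lambda>_. a))"
    unfolding contains_mat_def using rs assms(1-3)
    by (intro exI[of _ r] exI[of _ s]) (auto simp: image_subset_iff subset_iff)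
  moreover have "homogeneous_mat (mat t t (\<lambda>_. a))"
    by (auto simp: homogeneous_mat_def elements_mat_def)
  ultimately show ?thesis by (intro bexI[of _ "mat t t (\<lambda>_. a)"]) auto
qed

section \<open>Two rounds of cutting with explicit constants\<close>

text \<open>The quotient is at least 1, so rounding down loses at most a factor 2. This bounds a set
  by \<open>2 * d\<close> times the size of one of its \<open>d\<close> blocks.\<close>

lemma le_mult_div:
  fixes a d :: nat
  assumes "0 < d" and "d \<le> a"
  shows "a \<le> 2 * d * (a div d)"
proof -
  have "a = d * (a div d) + a mod d" by simp
  moreover have "a mod d < d" using assms by simp
  moreover have "d * 1 \<le> d * (a div d)"
    using assms by (intro mult_le_mono2) (simp add: div_greater_zero_iff Suc_le_eq)
  ultimately show ?thesis by linarith
qed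

text \<open>\<open>M\<close> bounds \<open>k + 1\<close> and \<open>l\<close> and is positive even
  for an empty \<open>P\<close>. Over both rounds rows lose at most a factor
  \<open>4 * M ^ 4\<close> and columns at most \<open>8 * M ^ 2 * (4 * M ^ 2) ^ k\<close>;
  \<open>D\<close> dominates both. The bound \<open>D \<le> n\<close> keeps the blocks of both cuts
  nonempty.\<close>

lemma linear_homogeneous_block:
  fixes P :: "int mat"
  assumes "zero_one_mat P"
    and "\<And>j. j < dim_col P \<Longrightarrow> card {i. i < dim_row P \<and> P $$ (i, j) = 1} \<le> 1"
  defines "k \<equiv> dim_row P" and "l \<equiv> dim_col P"
  defines "M \<equiv> (k + 1) * (l + 1)"
  defines "D \<equiv> 8 * M ^ 4 * (4 * M ^ 2) ^ k"
  assumes "D \<le> n" and "A \<in> carrier_mat n n" and "zero_one_mat A"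
    and "mat_free P A" and "mat_free (compl_mat P) A"
  shows "\<exists>X Y a. X \<subseteq> {..<n} \<and> Y \<subseteq> {..<n} \<and> n \<le> D * card X \<and> n \<le> D * card Y \<and>
    (\<forall>x\<in>X. \<forall>y\<in>Y. A $$ (x, y) = a)"
proof -
  have M: "M > 0" "k \<le> M" "l \<le> M" "k + 1 \<le> M" by (auto simp: M_def)
  \<comment> \<open>A block of the second cut of \<open>Y\<close> has at least
    \<open>card Y / (2 * M)\<close> columns, so density \<open>1 / m\<close> in \<open>Y\<close> may
    grow by a factor \<open>2 * M\<close>. This choice of \<open>m\<close> leaves density below
    \<open>1 / (2 * M)\<close>, which is at most the \<open>1 / (2 * (k + 1))\<close> required in
    the second round.\<close>
  define m where "m = 4 * M ^ 2"
  have m: "m > 0" "m ^ k > 0" using M by (auto simp: m_def)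
  have dims: "dim_row A = n" "dim_col A = n" using assms(8) by auto
  have D: "D = 8 * M ^ 4 * m ^ k" by (simp add: D_def m_def)
  have entry: "A $$ (x, y) = 0 \<or> A $$ (x, y) = 1" if "x < n" "y < n" for x y
    using that assms(9) dims by (force simp: zero_one_mat_def elements_mat_def)
  define q where "q = n div M"
  have "M * 1 \<le> M * (8 * M ^ 3 * m ^ k)"
    using M m by (intro mult_le_mono2) (simp add: Suc_le_eq)
  also have "\<dots> = D" by (simp add: D power_numeral_reduce)
  finally have nM: "M \<le> n" using assms(7) by simp
  have q: "q > 0" "n \<le> 2 * M * q"
    using nM M le_mult_div[of M n] by (auto simp: q_def div_greater_zero_iff)
  have qn: "M * q \<le> n" by (simp add: q_def)
  have "k * q \<le> card {..<n}" "l * q \<le> card {..<n}"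
    using qn mult_le_mono1[OF M(2), of q] mult_le_mono1[OF M(3), of q]
    unfolding card_lessThan by linarith+
  then obtain R C where
    R: "\<forall>i<k. R i \<subseteq> {..<n} \<and> card (R i) = q" "\<forall>i<k. \<forall>i'<i. \<forall>x\<in>R i'. \<forall>y\<in>R i. x < y" and
    C: "\<forall>j<l. C j \<subseteq> {..<n} \<and> card (C j) = q" "\<forall>j<l. \<forall>j'<j. \<forall>x\<in>C j'. \<forall>y\<in>C j. x < y"
    using ordered_blocks[of "{..<n}" k q] ordered_blocks[of "{..<n}" l q] by blast
  have nonempty: "finite Z \<and> Z \<noteq> {}" if "card Z = s" "s > 0" for Z :: "nat set" and s
    using that by (metis card_gt_0_iff)
  have "\<not> transversal_copy {..<k} {..<l} R C (\<lambda>x y. A $$ (x, y) = 1) (\<lambda>i j. P $$ (i, j) = 1)"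
  proof
    assume "transversal_copy {..<k} {..<l} R C (\<lambda>x y. A $$ (x, y) = 1) (\<lambda>i j. P $$ (i, j) = 1)"
    then have "contains_mat A P"
      by (rule contains_mat_if_transversal_copy[OF assms(9,1), of R C 1, folded k_def l_def,
            OF _ _ _ _ R(2) C(2)])
        (use R(1) C(1) dims in auto)
    with assms(10) show False by (simp add: mat_free_def)
  qed
  moreover have "finite (R i) \<and> R i \<noteq> {}" if "i \<in> {..<k}" for i
    using that R(1) nonempty q(1) by blast
  moreover have "finite (C j) \<and> C j \<noteq> {}" if "j \<in> {..<l}" for j
    using that C(1) nonempty q(1) by blast
  ultimately have "\<exists>i\<in>{..<k}. \<exists>j\<in>{..<l}. \<exists>X Y b. X \<subseteq> R i \<and> Y \<subseteq> C j \<and>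
      card (R i) \<le> card {..<l} * card X \<and> card (C j) \<le> m ^ card {..<k} * card Y \<and>
      (\<forall>x\<in>X. m * card {y\<in>Y. (A $$ (x, y) = 1) = b} < card Y)"
    by (intro transversal_copy_or_sparse[OF _ _ m(1), where p = "\<lambda>i j. P $$ (i, j) = 1"] finite_lessThan)
  then obtain i j X Y b where ij: "i < k" "j < l" and XY: "X \<subseteq> R i" "Y \<subseteq> C j"
      "card (R i) \<le> l * card X" "card (C j) \<le> m ^ k * card Y"
    and sparse: "\<forall>x\<in>X. m * card {y\<in>Y. (A $$ (x, y) = 1) = b} < card Y"
    unfolding card_lessThan Bex_def lessThan_iff by (elim exE conjE) (rule that)
  have sub: "X \<subseteq> {..<n}" "Y \<subseteq> {..<n}" using XY R(1) C(1) ij by blast+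
  then have fin: "finite X" "finite Y" by (auto intro: finite_subset)
  \<comment> \<open>\<open>\<beta>\<close> is the symbol that is rare in every row of
    \<open>X\<close> across \<open>Y\<close>.\<close>
  define \<beta> :: int where "\<beta> = (if b then 1 else 0)"
  have \<beta>: "(A $$ (x, y) = 1) = b \<longleftrightarrow> A $$ (x, y) = \<beta>" if "x < n" "y < n" for x y
    using entry[OF that] by (auto simp: \<beta>_def)
  define u where "u = card X div M"
  define v where "v = card Y div M"
  have nX: "n \<le> 2 * M * l * card X"
    using q(2) XY(3) R(1) ij by (metis le_trans mult.assoc mult_le_mono2)
  have nY: "n \<le> 2 * M * m ^ k * card Y"
    using q(2) XY(4) C(1) ij by (metis le_trans mult.assoc mult_le_mono2)
  \<comment> \<open>Were \<open>X\<close> smaller than \<open>M\<close>, the losses so far would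
    give \<open>n < D\<close>. The same reasoning applies to \<open>Y\<close> below.\<close>
  have XM: "M \<le> card X"
  proof (rule ccontr)
    assume "\<not> ?thesis"
    then have "2 * M * l * card X \<le> 2 * M * M * M"
      using M by (intro mult_le_mono) auto
    also have "\<dots> < M ^ 3 * (8 * M * m ^ k)"
    proof -
      have "M * m ^ k > 0" using M m by simp
      then have "2 < 8 * M * m ^ k" by linarith
      then have "M ^ 3 * 2 < M ^ 3 * (8 * M * m ^ k)" using M by (intro mult_strict_left_mono) auto
      then show ?thesis by (simp add: power3_eq_cube mult.commute)
    qed
    also have "\<dots> = D" by (simp add: D power_numeral_reduce)
    finally show False using nX assms(7) by simp
  qed
  have YM: "M \<le> card Y"
  proof (rule ccontr)
    assume "\<not> ?thesis"
    then have "2 * M * m ^ k * card Y \<le> 2 * M * m ^ k * M"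
      by (intro mult_le_mono) auto
    also have "\<dots> < M ^ 2 * m ^ k * (8 * M ^ 2)"
    proof -
      have "M ^ 2 > 0" using M by simp
      then have "2 < 8 * M ^ 2" by linarith
      then have "M ^ 2 * m ^ k * 2 < M ^ 2 * m ^ k * (8 * M ^ 2)"
        using M m by (intro mult_strict_left_mono) auto
      then show ?thesis by (simp add: power2_eq_square mult_ac)
    qed
    also have "\<dots> = D" by (simp add: D power_numeral_reduce)
    finally show False using nY assms(7) by simp
  qed
  have u: "u > 0" "card X \<le> 2 * M * u" and v: "v > 0" "card Y \<le> 2 * M * v"
    using XM YM M le_mult_div[of M] by (auto simp: u_def v_def div_greater_zero_iff)
  have "M * u \<le> card X" "M * v \<le> card Y" by (simp_all add: u_def v_def)
  then have "k * u \<le> card X" "l * v \<le> card Y"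
    using mult_le_mono1[OF M(2), of u] mult_le_mono1[OF M(3), of v] by linarith+
  then obtain R' C' where
    R': "\<forall>i<k. R' i \<subseteq> X \<and> card (R' i) = u" "\<forall>i<k. \<forall>i'<i. \<forall>x\<in>R' i'. \<forall>y\<in>R' i. x < y" and
    C': "\<forall>j<l. C' j \<subseteq> Y \<and> card (C' j) = v" "\<forall>j<l. \<forall>j'<j. \<forall>x\<in>C' j'. \<forall>y\<in>C' j. x < y"
    using ordered_blocks[of X k u] ordered_blocks[of Y l v] fin by blast
  have sub': "i < k \<Longrightarrow> R' i \<subseteq> {..<n}" "j < l \<Longrightarrow> C' j \<subseteq> {..<n}" for i j
    using R'(1) C'(1) sub by blast+
  \<comment> \<open>The forbidden pattern is chosen so that the rare symbol \<open>\<beta>\<close>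
    stands in \<open>Q\<close> exactly where \<open>P\<close> has its 1-entries, hence at most once
    per column.\<close>
  define Q where "Q = (if b then P else compl_mat P)"
  have Q: "dim_row Q = k" "dim_col Q = l" "mat_free Q A" "zero_one_mat Q"
    using assms(1,10,11)
    by (auto simp: Q_def k_def l_def compl_mat_def zero_one_mat_def elements_mat_def)
  have Q\<beta>: "Q $$ (i, j) = \<beta> \<longleftrightarrow> P $$ (i, j) = 1" if "i < k" "j < l" for i j
    using that assms(1)
    by (force simp: Q_def \<beta>_def k_def l_def compl_mat_def zero_one_mat_def elements_mat_def)
  have "\<not> transversal_copy {..<k} {..<l} R' C' (\<lambda>x y. A $$ (x, y) = \<beta>) (\<lambda>i j. Q $$ (i, j) = \<beta>)"
  proof
    assume "transversal_copy {..<k} {..<l} R' C' (\<lambda>x y. A $$ (x, y) = \<beta>) (\<lambda>i j. Q $$ (i, j) = \<beta>)"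
    then have "contains_mat A Q"
      by (rule contains_mat_if_transversal_copy[OF assms(9) Q(4), of R' C' \<beta>, unfolded Q(1,2),
            OF _ _ _ _ R'(2) C'(2)])
        (use sub' in \<open>simp_all add: \<beta>_def dims\<close>)
    with Q(3) show False by (simp add: mat_free_def)
  qed
  moreover have "2 * (k + 1) * card {y \<in> C' j. A $$ (x, y) = \<beta>} < card (C' j)"
    if "i < k" "j < l" "x \<in> R' i" for i j x
  proof -
    have x: "x \<in> X" using that R' by blast
    have "{y \<in> C' j. A $$ (x, y) = \<beta>} \<subseteq> {y\<in>Y. (A $$ (x, y) = 1) = b}"
      using C'(1) that(2) \<beta> sub x by blast
    then have "m * card {y \<in> C' j. A $$ (x, y) = \<beta>} \<le> m * card {y\<in>Y. (A $$ (x, y) = 1) = b}"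
      using fin by (intro mult_le_mono2 card_mono) auto
    also have "\<dots> < 2 * M * v" using sparse x v(2) by force
    finally have "2 * M * (2 * M * card {y \<in> C' j. A $$ (x, y) = \<beta>}) < 2 * M * v"
      by (simp add: m_def power2_eq_square mult_ac)
    then have "2 * M * card {y \<in> C' j. A $$ (x, y) = \<beta>} < v"
      by (simp only: mult_less_cancel1)
    moreover have "2 * (k + 1) * card {y \<in> C' j. A $$ (x, y) = \<beta>}
        \<le> 2 * M * card {y \<in> C' j. A $$ (x, y) = \<beta>}"
      using M(4) by (intro mult_le_mono) auto
    ultimately show ?thesis using C'(1) that(2) by simp
  qed
  moreover have "i = i'" if "i < k" "i' < k" "j < l" "Q $$ (i, j) = \<beta>" "Q $$ (i', j) = \<beta>" for i i' j
  proof -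
    have "i \<in> {i. i < dim_row P \<and> P $$ (i, j) = 1}" "i' \<in> {i. i < dim_row P \<and> P $$ (i, j) = 1}"
      using Q\<beta> that by (auto simp: k_def)
    then show ?thesis
      using assms(2)[of j] that(3) card_le_Suc0_iff_eq[of "{i. i < dim_row P \<and> P $$ (i, j) = 1}"]
      by (auto simp: l_def)
  qed
  moreover have "finite (R' i) \<and> R' i \<noteq> {}" if "i < k" for i
    using that R'(1) nonempty u(1) by blast
  moreover have "finite (C' j) \<and> C' j \<noteq> {}" if "j < l" for j
    using that C'(1) nonempty v(1) by blast
  ultimately have "\<exists>i\<in>{..<k}. \<exists>j\<in>{..<l}. \<exists>X Y. X \<subseteq> R' i \<and> Y \<subseteq> C' j \<and>
      card (R' i) \<le> card {..<l} * card X \<and> card (C' j) \<le> 2 * card Y \<and>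
      (\<forall>x\<in>X. \<forall>y\<in>Y. A $$ (x, y) \<noteq> \<beta>)"
    by (intro transversal_copy_or_empty[where p = "\<lambda>i j. Q $$ (i, j) = \<beta>"])
      (simp_all only: finite_lessThan lessThan_iff card_lessThan simp_thms)
  then obtain i' j' X' Y' where *: "i' < k" "j' < l" "X' \<subseteq> R' i'" "Y' \<subseteq> C' j'"
    "card (R' i') \<le> l * card X'" "card (C' j') \<le> 2 * card Y'" "\<forall>x\<in>X'. \<forall>y\<in>Y'. A $$ (x, y) \<noteq> \<beta>"
    unfolding card_lessThan Bex_def lessThan_iff by (elim exE conjE) (rule that)
  have uv: "u \<le> l * card X'" "v \<le> 2 * card Y'"
    using *(1,2,5,6) R'(1) C'(1) by metis+
  have XY': "X' \<subseteq> {..<n}" "Y' \<subseteq> {..<n}"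
    using * R'(1) C'(1) sub by blast+
  \<comment> \<open>Each round costs the rows a factor \<open>2 * M\<close> for cutting and
    \<open>l\<close> for the pigeonhole step.\<close>
  have "n \<le> 2 * M * l * (2 * M * (l * card X'))"
    using nX u(2) uv(1) by (meson le_trans mult_le_mono2)
  also have "\<dots> \<le> 2 * M * M * (2 * M * (M * card X'))"
    using M by (intro mult_le_mono) auto
  also have "\<dots> = 4 * M ^ 4 * 1 * card X'" by (simp add: power_numeral_reduce)
  also have "\<dots> \<le> D * card X'" unfolding D using m by (intro mult_le_mono) auto
  finally have "n \<le> D * card X'" .
  moreover have "n \<le> D * card Y'"
  proof -
    \<comment> \<open>Columns lose \<open>2 * M\<close> in each cut, \<open>m ^ k\<close> in the
      greedy round and 2 in the counting round.\<close>
    have "n \<le> 2 * M * m ^ k * (2 * M * (2 * card Y'))"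
      using nY v(2) uv(2) by (meson le_trans mult_le_mono2)
    also have "\<dots> = 8 * M ^ 2 * m ^ k * card Y'" by (simp add: power2_eq_square)
    also have "\<dots> \<le> D * card Y'"
      unfolding D using M(1) by (intro mult_le_mono power_increasing) (auto simp: Suc_le_eq m)
    finally show ?thesis .
  qed
  moreover have "\<forall>x\<in>X'. \<forall>y\<in>Y'. A $$ (x, y) = 1 - \<beta>"
    using *(7) entry XY' by (fastforce simp: \<beta>_def)
  ultimately show ?thesis using XY' by blast
qed

section \<open>Passing to a real constant and small matrices\<close>

theorem theorem2p6:
  fixes P :: "int mat"
  assumes "zero_one_mat P"
    and "\<And>j. j < dim_col P \<Longrightarrow> card {i. i < dim_row P \<and> P $$ (i, j) = 1} \<le> 1"
  shows "\<exists>c::real. c > 0 \<and>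
    (\<forall>n. \<forall>A \<in> carrier_mat n n.
       zero_one_mat A \<longrightarrow> mat_free P A \<longrightarrow> mat_free (compl_mat P) A \<longrightarrow>
       (\<exists>B \<in> carrier_mat (nat \<lceil>c * real n\<rceil>) (nat \<lceil>c * real n\<rceil>).
          contains_mat A B \<and> homogeneous_mat B))"
proof -
  define M where "M = (dim_row P + 1) * (dim_col P + 1)"
  define D where "D = 8 * M ^ 4 * (4 * M ^ 2) ^ dim_row P"
  have "D > 0" by (auto simp: D_def M_def)
  have "\<exists>B \<in> carrier_mat (nat \<lceil>1 / real D * real n\<rceil>) (nat \<lceil>1 / real D * real n\<rceil>).
      contains_mat A B \<and> homogeneous_mat B"
    if A: "A \<in> carrier_mat n n" "zero_one_mat A" "mat_free P A" "mat_free (compl_mat P) A" for n A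
  proof -
    have "\<exists>X Y a. X \<subseteq> {..<n} \<and> Y \<subseteq> {..<n} \<and> n \<le> D * card X \<and> n \<le> D * card Y \<and>
        (\<forall>x\<in>X. \<forall>y\<in>Y. A $$ (x, y) = a)"
    proof (cases "D \<le> n")
      case True
      then show ?thesis
        using linear_homogeneous_block[OF assms _ A] by (simp add: D_def M_def)
    next
      \<comment> \<open>Below the threshold a single entry is large enough, and for
        \<open>n = 0\<close> the empty sets serve.\<close>
      case False
      then show ?thesis
        by (cases "n = 0")
          (auto intro!: exI[of _ "{0}"] exI[of _ "A $$ (0, 0)"])
    qed
    then obtain X Y a where XY: "X \<subseteq> {..<n}" "Y \<subseteq> {..<n}" "n \<le> D * card X" "n \<le> D * card Y"
      "\<forall>x\<in>X. \<forall>y\<in>Y. A $$ (x, y) = a" by blast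
    \<comment> \<open>Rounding \<open>n / D\<close> up is harmless because the bound
      \<open>z\<close> is an integer.\<close>
    have size: "nat \<lceil>1 / real D * real n\<rceil> \<le> z" if "n \<le> D * z" for z
    proof -
      have "real n \<le> real D * real z" using that by (metis of_nat_le_iff of_nat_mult)
      then have "1 / real D * real n \<le> real z"
        using \<open>D > 0\<close> by (simp add: field_simps)
      then show ?thesis by (simp add: ceiling_le_iff nat_le_iff)
    qed
    show ?thesis
      using XY A(1) size by (intro contains_homogeneous_mat[of X _ Y a]) auto
  qed
  then show ?thesis
    using \<open>D > 0\<close> by (intro exI[of _ "1 / real D"]) simp
qed

end
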